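(* The generating function of interval-closed sets of $\mathbf{A}_{n-1}$ can be expressed as $$\sum_{n\ge0} \left|\mathcal{IC}(\mathbf{A}_{n-1})\right|z^{2n}=F(0,0,z),$$ where $F(x,y):=F(x,y,z)$ is a formal power series in $z$ with coefficients that are polynomials in $x$ and $y$, satisfying the functional equation $$F(x,y)= 1+z\left(x+\frac{1}{x}+\frac{x}{y}+\frac{y}{x}\right)F(x,y) - z \left(\frac{1}{x}+\frac{y}{x}\right)F(0,y) - z\, \frac{x}{y} F(x,0) - z^2\, \left(F(x,0)-F(0,0)\right).$$
   Context: For a finite poset $P$, a subset $I\subseteq P$ is an interval-closed set if for all $a,b\in I$ and $w\in P$ with $a<w<b$ we have $w\in I$; $\mathcal{IC}(P)$ is the set of all interval-closed sets of $P$ (including the empty set). $\mathbf{A}_k$ is the poset of positive roots of type $A_k$ (the triangular poset with $k$ minimal elements): its elements are the intervals $[i,j]$ with $1\le i\le j\le k$, ordered by inclusion. By convention $\mathbf{A}_0$ and $\mathbf{A}_{-1}$ are empty posets, each having exactly one ICS. In the functional equation, the variable $z$ is suppressed: $F(0,y)=F(0,y,z)$, $F(x,0)=F(x,0,z)$, $F(0,0)=F(0,0,z)$. *)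

theory Defs
  imports "HOL-Computational_Algebra.Computational_Algebra"
begin

definition interval_closed_sets :: "'a::order set \<Rightarrow> 'a set set" where
  "interval_closed_sets P =
     {I. I \<subseteq> P \<and> (\<forall>a\<in>I. \<forall>b\<in>I. \<forall>w\<in>P. a < w \<and> w < b \<longrightarrow> w \<in> I)}"

(* The order is inclusion of sets. The index is an integer, so that k = 0 and k = -1 both give
   the empty poset. *)
definition root_poset_A :: "int \<Rightarrow> int set set" where
  "root_poset_A k = {{i..j} | i j. 1 \<le> i \<and> i \<le> j \<and> j \<le> k}"

(* An element of int poly poly is a polynomial in x and y over the integers: the outer
   variable is x, and the coefficients are polynomials in y. *)
definition bipoly_eval :: "int poly poly \<Rightarrow> 'a::comm_ring_1 \<Rightarrow> 'a \<Rightarrow> 'a" where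
  "bipoly_eval p a b = poly (map_poly (\<lambda>q. poly (map_poly of_int q) b) p) a"

(* For F = F(x,y,z), a power series in z with coefficients in Z[x,y], this is F(a,b,z). *)
definition fps_at :: "int poly poly fps \<Rightarrow> 'a::comm_ring_1 \<Rightarrow> 'a \<Rightarrow> 'a fps" where
  "fps_at F a b = Abs_fps (\<lambda>n. bipoly_eval (fps_nth F n) a b)"

type_synonym ratfun = "int poly poly fract"

definition rat_x :: ratfun where "rat_x = to_fract [:0, 1:]"

definition rat_y :: ratfun where "rat_y = to_fract [:[:0, 1:]:]"

(* The equation contains 1/x and x/y, so it is an identity of power series in z over the field
   of rational functions in x and y. *)
definition functional_equation :: "int poly poly fps \<Rightarrow> bool" where
  "functional_equation F \<longleftrightarrow>
     (let x = rat_x; y = rat_y; z = fps_X; c = fps_const in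
        fps_at F x y =
          1 + z * c (x + 1 / x + x / y + y / x) * fps_at F x y
            - z * c (1 / x + y / x) * fps_at F 0 y
            - z * c (x / y) * fps_at F x 0
            - z\<^sup>2 * (fps_at F x 0 - fps_at F 0 0))"

end

theory Submission
  imports Defs
begin

text \<open>
  Both sides count the same lattice walks. Comparing coefficients of powers of \<open>z\<close>, the functional
  equation becomes a two-step recurrence \<open>p\<^bsub>n+2\<^esub> = T p\<^bsub>n+1\<^esub> - N p\<^bsub>n\<^esub>\<close> for polynomials in \<open>x\<close> and
  \<open>y\<close> (\<open>functional_equation_iff_recurrence\<close>): the subtracted terms \<open>F(0,y)\<close> and \<open>F(x,0)\<close> are what
  makes the divisions by \<open>x\<close> and \<open>y\<close> exact. So there is exactly one solution. The recurrence says
  that the coefficient of \<open>x\<^sup>i y\<^sup>j z\<^sup>m\<close> is the number of walks with \<open>m\<close> steps from the origin to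
  \<open>(i, j)\<close> inside the quarter plane with the steps \<open>(1, 0)\<close>, \<open>(-1, 0)\<close>, \<open>(1, -1)\<close>, \<open>(-1, 1)\<close> that
  never go \<open>(i, 0)\<close>, \<open>(i + 1, 0)\<close>, \<open>(i, 0)\<close> with \<open>i > 0\<close>; the term with \<open>z\<^sup>2\<close> removes the walks
  that end with this pattern (\<open>coeff_functional_equation_solution\<close>).

  A point \<open>(i, j)\<close> of the quarter plane is read as a pair of heights \<open>i \<le> i + 2 * j\<close>. The four
  steps then are the four ways in which two lattice paths can both go up or down by one, so a
  closed walk with \<open>2 * n\<close> steps is a pair of Dyck paths of semilength \<open>n\<close>, one weakly below the
  other. The forbidden pattern is a peak of height at least 2 that both paths share.

  Dyck paths of semilength \<open>n\<close> correspond to the order ideals of the root poset with \<open>n - 1\<close>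
  minimal elements: draw \<open>[i, j]\<close> at position \<open>i + j\<close> and height \<open>j - i + 2\<close>, and take the
  elements that are not above the path (\<open>dyck_path_mono_ideal_below\<close>, \<open>dyck_path_of_order_ideal\<close>).
  An interval-closed set \<open>I\<close> is the difference of the ideal \<open>J\<close> that it generates and the ideal
  \<open>J-I\<close>. Among all representations of \<open>I\<close> as a difference of nested ideals this one is singled out
  by the condition that every maximal element of the larger ideal lies outside the smaller one.
  Maximal elements are peaks of the upper path of height at least 2, so this is exactly the
  absence of shared peaks (\<open>ideal_below_eq_down_closure_region\<close>), and the pairs of paths without
  shared peaks are in bijection with the interval-closed sets
  (\<open>bij_betw_walks_interval_closed_sets\<close>).
\<close>

section \<open>The functional equation as a recurrence for polynomials\<close>

lemma of_int_ratfun: "(of_int a :: ratfun) = to_fract [:[:a:]:]"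
proof -
  have "(of_int a :: ratfun) = to_fract (of_int a)"
    by (induction a rule: int_induct[of _ 0]) simp_all
  then show ?thesis
    by (simp add: of_int_poly)
qed

lemma poly_map_of_int_rat_y: "poly (map_poly of_int q) rat_y = to_fract [:q:]"
proof (induction q)
  case 0
  then show ?case by simp
next
  case (pCons a q)
  have 2: "[:pCons a q:] = [:[:a:]:] + [:[:0, 1:]:] * [:q:]"
    by simp
  have "poly (map_poly of_int (pCons a q)) rat_y = to_fract [:[:a:]:] + rat_y * to_fract [:q:]"
    by (simp add: map_poly_pCons flip: of_int_ratfun pCons.IH)
  then show ?case
    by (subst 2) (simp only: to_fract_add to_fract_mult rat_y_def)
qed

lemma bipoly_eval_rat: "bipoly_eval p rat_x rat_y = to_fract p"
proof (induction p)
  case 0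
  then show ?case by (simp add: bipoly_eval_def)
next
  case (pCons a p)
  have 2: "pCons a p = [:a:] + [:0, 1:] * p"
    by simp
  have "bipoly_eval (pCons a p) rat_x rat_y = to_fract [:a:] + rat_x * bipoly_eval p rat_x rat_y"
    by (simp add: bipoly_eval_def map_poly_pCons poly_map_of_int_rat_y)
  then show ?case
    unfolding pCons.IH by (subst 2) (simp only: to_fract_add to_fract_mult rat_x_def)
qed

definition x_axis_part :: "int poly poly \<Rightarrow> int poly poly" where
  "x_axis_part = map_poly (\<lambda>q. [:coeff q 0:])"

lemma coeff_x_axis_part [simp]: "coeff (x_axis_part p) i = [:coeff (coeff p i) 0:]"
  by (simp add: x_axis_part_def coeff_map_poly)

lemma poly_map_of_int_0: "poly (map_poly of_int q) 0 = of_int (coeff q 0)"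
  by (simp add: poly_0_coeff_0 coeff_map_poly)

lemma bipoly_eval_x_0: "bipoly_eval p rat_x 0 = to_fract (x_axis_part p)"
proof -
  have "bipoly_eval (x_axis_part p) rat_x rat_y = bipoly_eval p rat_x 0"
    unfolding bipoly_eval_def x_axis_part_def
    by (simp add: map_poly_map_poly o_def poly_map_of_int_0 map_poly_pCons)
  then show ?thesis
    by (simp add: bipoly_eval_rat)
qed

lemma bipoly_eval_0: "bipoly_eval p 0 b = poly (map_poly of_int (coeff p 0)) b"
  by (simp add: bipoly_eval_def poly_0_coeff_0 coeff_map_poly)

lemma bipoly_eval_0_0: "bipoly_eval p 0 0 = of_int (coeff (coeff p 0) 0)"
  by (simp add: bipoly_eval_0 poly_map_of_int_0)

lemma bipoly_eval_0_y: "bipoly_eval p 0 rat_y = to_fract [:coeff p 0:]"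
  by (simp add: bipoly_eval_0 poly_map_of_int_rat_y)

text \<open>Since \<open>poly_shift 1 p\<close> is \<open>(p - p(0,y)) / x\<close> and its coefficientwise application is \<open>(p -
  p(x,0)) / y\<close>, this is \<open>x p + (1 + y) (p - p(0,y)) / x + x (p - p(x,0)) / y\<close>, which collects the
  four terms of the functional equation that are linear in \<open>z\<close>.\<close>

definition step_operator :: "int poly poly \<Rightarrow> int poly poly" where
  "step_operator p =
     pCons 0 p + smult [:1, 1:] (poly_shift 1 p) + pCons 0 (map_poly (poly_shift 1) p)"

text \<open>The factor \<open>p(x,0) - p(0,0)\<close> of \<open>z\<^sup>2\<close>. It keeps the monomials \<open>x\<^sup>i\<close> with \<open>i > 0\<close>, the end
  points at which a walk can complete a forbidden peak.\<close>

definition peak_operator :: "int poly poly \<Rightarrow> int poly poly" where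
  "peak_operator p = x_axis_part p - [:[:coeff (coeff p 0) 0:]:]"

lemma rat_x_nonzero: "rat_x \<noteq> 0" and rat_y_nonzero: "rat_y \<noteq> 0"
  by (simp_all add: rat_x_def rat_y_def)

lemma pCons_poly_shift_1: "pCons 0 (poly_shift 1 p) = p - [:coeff p 0:]"
  by (intro poly_eqI) (auto simp: coeff_pCons coeff_poly_shift split: nat.splits)

lemma y_mult_map_poly_shift_1: "smult [:0, 1:] (map_poly (poly_shift 1) p) = p - x_axis_part p"
  by (intro poly_eqI)
    (auto simp: coeff_pCons coeff_poly_shift coeff_map_poly split: nat.splits)

lemma to_fract_pCons_0: "to_fract (pCons 0 p) = rat_x * to_fract p"
  unfolding rat_x_def by (simp flip: to_fract_mult)

lemma to_fract_smult: "to_fract (smult c p) = to_fract [:c:] * to_fract p"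
  by (simp flip: to_fract_mult)

lemma to_fract_step_operator:
  "to_fract (step_operator p) =
     (rat_x + 1 / rat_x + rat_x / rat_y + rat_y / rat_x) * to_fract p
     - (1 / rat_x + rat_y / rat_x) * to_fract [:coeff p 0:]
     - rat_x / rat_y * to_fract (x_axis_part p)"
proof -
  have x: "rat_x * to_fract (poly_shift 1 p) = to_fract p - to_fract [:coeff p 0:]"
    by (metis pCons_poly_shift_1 to_fract_diff to_fract_pCons_0)
  have y: "rat_y * to_fract (map_poly (poly_shift 1) p) = to_fract p - to_fract (x_axis_part p)"
    unfolding rat_y_def by (metis y_mult_map_poly_shift_1 to_fract_diff to_fract_smult)
  have "to_fract [:[:1, 1:]:] = 1 + rat_y"
    unfolding rat_y_def to_fract_1[symmetric] to_fract_add[symmetric] by (simp add: one_pCons)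
  then have "to_fract (step_operator p) = rat_x * to_fract p
      + (1 + rat_y) * to_fract (poly_shift 1 p) + rat_x * to_fract (map_poly (poly_shift 1) p)"
    by (simp only: step_operator_def to_fract_add to_fract_pCons_0 to_fract_smult)
  moreover have "to_fract (poly_shift 1 p) = (to_fract p - to_fract [:coeff p 0:]) / rat_x"
    using x rat_x_nonzero by (simp add: field_simps)
  moreover have
    "to_fract (map_poly (poly_shift 1) p) = (to_fract p - to_fract (x_axis_part p)) / rat_y"
    using y rat_y_nonzero by (simp add: field_simps)
  ultimately show ?thesis
    by (simp only:) (simp add: rat_x_nonzero rat_y_nonzero field_simps)
qed

lemma all_nat_iff_0_1_add_2: "(\<forall>n::nat. P n) \<longleftrightarrow> P 0 \<and> P 1 \<and> (\<forall>n. P (n + 2))"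
  by (metis One_nat_def add_2_eq_Suc' not0_implies_Suc)

text \<open>Both sides of the equation are series over the field of rational functions, but after
  \<open>to_fract_step_operator\<close> each coefficient lies in the image of the polynomial ring, and the
  embedding is injective.\<close>

lemma functional_equation_iff_recurrence:
  "functional_equation F \<longleftrightarrow>
     fps_nth F 0 = 1 \<and> fps_nth F 1 = step_operator (fps_nth F 0) \<and>
     (\<forall>n. fps_nth F (n + 2) = step_operator (fps_nth F (n + 1)) - peak_operator (fps_nth F n))"
  (is "_ \<longleftrightarrow> ?R")
proof -
  let ?P = "\<lambda>n. to_fract (fps_nth F n)"
  let ?rhs = "\<lambda>n. (if n = 0 then 1 else 0)
       + (if n = 0 then 0 else to_fract (step_operator (fps_nth F (n - 1))))
       - (if n < 2 then 0 else to_fract (peak_operator (fps_nth F (n - 2))))"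
  have "functional_equation F \<longleftrightarrow> (\<forall>n. ?P n = ?rhs n)"
    unfolding functional_equation_def Let_def fps_eq_iff
    by (intro all_cong1)
      (simp add: fps_at_def mult.assoc fps_X_power_mult_nth bipoly_eval_rat bipoly_eval_x_0
        bipoly_eval_0_y bipoly_eval_0_0 of_int_ratfun to_fract_step_operator peak_operator_def)
  also have "\<dots> \<longleftrightarrow> ?P 0 = ?rhs 0 \<and> ?P 1 = ?rhs 1 \<and> (\<forall>n. ?P (n + 2) = ?rhs (n + 2))"
    by (rule all_nat_iff_0_1_add_2)
  also have "\<dots> \<longleftrightarrow> ?R"
    by (simp flip: to_fract_diff to_fract_1)
  finally show ?thesis .
qed

fun series_coeff :: "nat \<Rightarrow> int poly poly" where
  "series_coeff 0 = 1"
| "series_coeff (Suc 0) = step_operator 1"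
| "series_coeff (Suc (Suc n)) = step_operator (series_coeff (Suc n)) - peak_operator (series_coeff n)"

lemma functional_equation_solvable: "\<exists>F. functional_equation F"
  by (rule exI[of _ "Abs_fps series_coeff"]) (simp add: functional_equation_iff_recurrence)

section \<open>Coefficients of the solution as numbers of walks\<close>

lemma coeff_step_operator:
  "coeff (coeff (step_operator p) i) j =
     (if i = 0 then 0 else coeff (coeff p (i - 1)) j)
     + coeff (coeff p (Suc i)) j
     + (if j = 0 then 0 else coeff (coeff p (Suc i)) (j - 1))
     + (if i = 0 then 0 else coeff (coeff p (i - 1)) (Suc j))"
  by (cases i; cases j) (simp_all add: step_operator_def coeff_poly_shift coeff_map_poly)

lemma coeff_peak_operator:
  "coeff (coeff (peak_operator p) i) j = (if 0 < i \<and> j = 0 then coeff (coeff p i) 0 else 0)"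
  by (auto simp: peak_operator_def coeff_pCons split: nat.splits)

text \<open>The condition is symmetric in its two points: reversing a walk permutes the four steps.\<close>

fun adjacent :: "nat \<times> nat \<Rightarrow> nat \<times> nat \<Rightarrow> bool" where
  "adjacent (i, j) (i', j') \<longleftrightarrow>
     i' = Suc i \<and> (j' = j \<or> j = Suc j') \<or> i = Suc i' \<and> (j' = j \<or> j' = Suc j)"

text \<open>The step \<open>(1, 0)\<close> followed by \<open>(-1, 0)\<close> on the \<open>x\<close>-axis, away from the origin. For the pair
  of paths encoded by a walk this is a peak that both paths have at the same place, of height at
  least 2. A peak of height 1 is harmless, as it corresponds to no element of the poset.\<close>

definition shared_peak :: "nat \<times> nat \<Rightarrow> nat \<times> nat \<Rightarrow> nat \<times> nat \<Rightarrow> bool" where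
  "shared_peak p q r \<longleftrightarrow> p = r \<and> 0 < fst p \<and> snd p = 0 \<and> q = (Suc (fst p), 0)"

text \<open>The list starts at the end point of the walk and finishes at the origin, so that appending a
  step is \<open>Cons\<close>.\<close>

definition walks :: "nat \<Rightarrow> nat \<times> nat \<Rightarrow> (nat \<times> nat) list set" where
  "walks m p = {w. length w = Suc m \<and> w ! 0 = p \<and> w ! m = (0, 0) \<and>
     (\<forall>t<m. adjacent (w ! t) (w ! Suc t)) \<and>
     (\<forall>t. Suc t < m \<longrightarrow> \<not> shared_peak (w ! t) (w ! Suc t) (w ! Suc (Suc t)))}"

lemma walks_0: "walks 0 p = (if p = (0, 0) then {[p]} else {})"
  by (auto simp: walks_def length_Suc_conv)

lemma Cons_in_walks_Suc_iff:
  "p # w \<in> walks (Suc m) p' \<longleftrightarrow>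
     p = p' \<and> adjacent p (w ! 0) \<and> w \<in> walks m (w ! 0) \<and>
     (0 < m \<longrightarrow> \<not> shared_peak p (w ! 0) (w ! 1))"
proof -
  have adj: "(\<forall>t<Suc m. adjacent ((p # w) ! t) ((p # w) ! Suc t)) \<longleftrightarrow>
      adjacent p (w ! 0) \<and> (\<forall>t<m. adjacent (w ! t) (w ! Suc t))"
    unfolding All_less_Suc2 by simp
  have "(\<forall>t. Suc t < Suc m \<longrightarrow> Q t) \<longleftrightarrow> (0 < m \<longrightarrow> Q 0) \<and> (\<forall>t. Suc t < m \<longrightarrow> Q (Suc t))"
    for Q :: "nat \<Rightarrow> bool"
    by (metis Suc_less_eq not0_implies_Suc)
  note peak = this[of "\<lambda>t. \<not> shared_peak ((p # w) ! t) ((p # w) ! Suc t) ((p # w) ! Suc (Suc t))"]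
  show ?thesis
    unfolding walks_def mem_Collect_eq adj peak by auto
qed

lemma walks_Suc_cases:
  assumes "w \<in> walks (Suc m) p"
  obtains w' where "w = p # w'"
  using assms by (cases w) (auto simp: walks_def)

lemma walks_hd: "w \<in> walks m p \<Longrightarrow> w ! 0 = p"
  by (simp add: walks_def)

definition extended_walks :: "nat \<Rightarrow> nat \<times> nat \<Rightarrow> (nat \<times> nat) list set" where
  "extended_walks m p = (\<Union>q\<in>{q. adjacent p q}. Cons p ` walks m q)"

text \<open>The walks to \<open>p\<close> whose last two steps form a shared peak. Deleting the peak leaves an
  arbitrary admissible walk to \<open>p\<close> with two steps fewer.\<close>

definition peak_walks :: "nat \<Rightarrow> nat \<times> nat \<Rightarrow> (nat \<times> nat) list set" where
  "peak_walks m p =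
     (if 0 < fst p \<and> snd p = 0 then (\<lambda>w. p # (Suc (fst p), 0) # w) ` walks m p else {})"

lemma in_extended_walks_iff:
  "v \<in> extended_walks m p \<longleftrightarrow> (\<exists>w. v = p # w \<and> adjacent p (w ! 0) \<and> w \<in> walks m (w ! 0))"
  unfolding extended_walks_def using walks_hd by blast

lemma in_peak_walks_iff:
  "p # q # w \<in> peak_walks m p \<longleftrightarrow> w \<in> walks m (w ! 0) \<and> shared_peak p q (w ! 0)"
proof -
  have "w \<in> walks m p \<longleftrightarrow> w \<in> walks m (w ! 0) \<and> p = w ! 0"
    using walks_hd by metis
  then show ?thesis
    unfolding peak_walks_def shared_peak_def by auto
qed

lemma walks_Suc_0: "walks (Suc 0) p = extended_walks 0 p"
proof (intro set_eqI iffI)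
  fix w assume w: "w \<in> walks (Suc 0) p"
  then obtain w' where "w = p # w'"
    by (rule walks_Suc_cases)
  with w show "w \<in> extended_walks 0 p"
    by (auto simp: Cons_in_walks_Suc_iff in_extended_walks_iff)
qed (auto simp: Cons_in_walks_Suc_iff in_extended_walks_iff)

lemma walks_Suc_Suc: "walks (Suc (Suc m)) p = extended_walks (Suc m) p - peak_walks m p"
proof (rule set_eqI)
  fix v
  have *: "p # w \<in> peak_walks m p \<longleftrightarrow> shared_peak p (w ! 0) (w ! 1)"
    if w: "w \<in> walks (Suc m) (w ! 0)" for w
  proof -
    obtain u where u: "w = w ! 0 # u"
      using w by (rule walks_Suc_cases)
    then have "u \<in> walks m (u ! 0)"
      using w by (metis Cons_in_walks_Suc_iff)
    then show ?thesis
      by (subst (1) u, subst (2) u) (simp add: in_peak_walks_iff)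
  qed
  show "v \<in> walks (Suc (Suc m)) p \<longleftrightarrow> v \<in> extended_walks (Suc m) p - peak_walks m p"
  proof (cases "\<exists>w. v = p # w")
    case True
    then show ?thesis
      using * by (auto simp: Cons_in_walks_Suc_iff in_extended_walks_iff)
  next
    case False
    then show ?thesis
      by (auto simp: in_extended_walks_iff elim: walks_Suc_cases)
  qed
qed

text \<open>The part up to the top of the final peak is itself an admissible walk: its last step is \<open>(1,
  0)\<close>, while a forbidden pattern ends with \<open>(-1, 0)\<close>. This is why the number of walks to be
  subtracted is a plain count of walks to \<open>p\<close>.\<close>

lemma peak_walks_subset: "peak_walks m p \<subseteq> extended_walks (Suc m) p"
proof (cases "0 < fst p \<and> snd p = 0")
  case True
  then obtain i where p: "p = (i, 0)" "0 < i"
    by (cases p) auto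
  have "(Suc i, 0) # w \<in> walks (Suc m) (Suc i, 0)" if "w \<in> walks m p" for w
    using that p walks_hd[OF that] by (auto simp: Cons_in_walks_Suc_iff shared_peak_def)
  with p show ?thesis
    by (auto simp: peak_walks_def in_extended_walks_iff)
qed (auto simp: peak_walks_def)

lemma Collect_adjacent:
  "{q. adjacent (i, j) q} =
     {(Suc i, j)} \<union> (if i = 0 then {} else {(i - 1, j)})
     \<union> (if j = 0 then {} else {(Suc i, j - 1)}) \<union> (if i = 0 then {} else {(i - 1, Suc j)})"
  by auto

lemma finite_adjacent: "finite {q. adjacent p q}"
  by (cases p) (simp only: Collect_adjacent, simp)

lemma finite_walks: "finite (walks m p)"
proof (induction m arbitrary: p)
  case 0
  then show ?case by (simp add: walks_0)
next
  case (Suc m)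
  have "walks (Suc m) p \<subseteq> extended_walks m p"
    by (cases m) (auto simp: walks_Suc_0 walks_Suc_Suc)
  then show ?case
    by (rule finite_subset) (simp add: extended_walks_def Suc.IH finite_adjacent)
qed

lemma finite_extended_walks: "finite (extended_walks m p)"
  by (simp add: extended_walks_def finite_adjacent finite_walks)

lemma card_extended_walks: "card (extended_walks m p) = (\<Sum>q | adjacent p q. card (walks m q))"
proof -
  have "Cons p ` walks m q \<inter> Cons p ` walks m q' = {}" if "q \<noteq> q'" for q q'
    using that walks_hd by blast
  then have "card (extended_walks m p) = (\<Sum>q | adjacent p q. card (Cons p ` walks m q))"
    unfolding extended_walks_def
    by (intro card_UN_disjoint) (simp_all add: finite_adjacent finite_walks)
  then show ?thesis
    by (simp add: card_image inj_on_def)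
qed

lemma card_peak_walks:
  "card (peak_walks m p) = (if 0 < fst p \<and> snd p = 0 then card (walks m p) else 0)"
  by (simp add: peak_walks_def card_image inj_on_def)

lemma sum_adjacent:
  "(\<Sum>q | adjacent (i, j) q. f q) =
     (if i = 0 then 0 else f (i - 1, j)) + f (Suc i, j)
     + (if j = 0 then 0 else f (Suc i, j - 1)) + (if i = 0 then 0 else f (i - 1, Suc j))"
  for f :: "nat \<times> nat \<Rightarrow> int"
  unfolding Collect_adjacent by (cases i; cases j; simp)

lemma card_walks_Suc_Suc:
  "int (card (walks (Suc (Suc m)) p)) = (\<Sum>q | adjacent p q. int (card (walks (Suc m) q)))
     - (if 0 < fst p \<and> snd p = 0 then int (card (walks m p)) else 0)"
proof -
  have "card (peak_walks m p) \<le> card (extended_walks (Suc m) p)"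
    using finite_extended_walks peak_walks_subset by (rule card_mono)
  then show ?thesis
    unfolding walks_Suc_Suc
    by (subst card_Diff_subset[OF finite_subset[OF peak_walks_subset finite_extended_walks]
          peak_walks_subset])
      (simp add: card_extended_walks card_peak_walks)
qed

text \<open>The four terms of \<open>coeff_step_operator\<close> are the four possible predecessors of \<open>(i, j)\<close>, the
  vanishing ones being those outside the quarter plane, and \<open>peak_operator\<close> subtracts
  \<open>peak_walks\<close>.\<close>

lemma coeff_functional_equation_solution:
  assumes "functional_equation F"
  shows "coeff (coeff (fps_nth F m) i) j = int (card (walks m (i, j)))"
proof -
  note rec = assms[unfolded functional_equation_iff_recurrence]
  have 0: "coeff (coeff (fps_nth F 0) i) j = int (card (walks 0 (i, j)))" for i j
    using rec by (simp add: walks_0)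
  have 1: "coeff (coeff (fps_nth F (Suc 0)) i) j = int (card (walks (Suc 0) (i, j)))" for i j
  proof -
    have "int (card (walks (Suc 0) (i, j))) =
        (\<Sum>q | adjacent (i, j) q. coeff (coeff (fps_nth F 0) (fst q)) (snd q))"
      by (simp add: walks_Suc_0 card_extended_walks 0)
    also have "\<dots> = coeff (coeff (step_operator (fps_nth F 0)) i) j"
      by (simp only: sum_adjacent coeff_step_operator fst_conv snd_conv)
    finally show ?thesis
      using rec by simp
  qed
  have 2: "coeff (coeff (fps_nth F (Suc (Suc m))) i) j = int (card (walks (Suc (Suc m)) (i, j)))"
    if "\<And>i j. coeff (coeff (fps_nth F m) i) j = int (card (walks m (i, j)))"
      "\<And>i j. coeff (coeff (fps_nth F (Suc m)) i) j = int (card (walks (Suc m) (i, j)))" for m i j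
    using rec that by (simp add: card_walks_Suc_Suc sum_adjacent coeff_step_operator coeff_peak_operator)
  have "(\<forall>i j. coeff (coeff (fps_nth F m) i) j = int (card (walks m (i, j)))) \<and>
     (\<forall>i j. coeff (coeff (fps_nth F (Suc m)) i) j = int (card (walks (Suc m) (i, j))))"
    using 0 1 2 by (induction m) simp_all
  then show ?thesis by blast
qed

section \<open>Order ideals of the root poset and Dyck paths\<close>

lemma Icc_in_root_poset_A_iff: "{i..j} \<in> root_poset_A k \<longleftrightarrow> 1 \<le> i \<and> i \<le> j \<and> j \<le> k" if "i \<le> j"
  using that by (auto simp: root_poset_A_def Icc_eq_Icc)

lemma root_poset_A_cases:
  assumes "p \<in> root_poset_A k"
  obtains i j where "p = {i..j}" "1 \<le> i" "i \<le> j" "j \<le> k"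
  using assms by (auto simp: root_poset_A_def)

lemma finite_root_poset_A: "finite (root_poset_A k)"
proof (rule finite_subset)
  show "root_poset_A k \<subseteq> (\<lambda>(i, j). {i..j}) ` ({1..k} \<times> {1..k})"
    by (force simp: root_poset_A_def)
qed simp

definition order_ideal :: "'a::order set \<Rightarrow> 'a set \<Rightarrow> bool" where
  "order_ideal P J \<longleftrightarrow> J \<subseteq> P \<and> (\<forall>b\<in>J. \<forall>a\<in>P. a \<le> b \<longrightarrow> a \<in> J)"

text \<open>A path is given by its heights at the positions \<open>0, \<dots>, 2 * n\<close>, with arbitrary values
  elsewhere. Positions and heights are integers because the positions arise as sums \<open>i + j\<close> of
  integer end points.\<close>

definition dyck_path :: "int \<Rightarrow> (int \<Rightarrow> int) \<Rightarrow> bool" where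
  "dyck_path n h \<longleftrightarrow> h 0 = 0 \<and> h (2 * n) = 0 \<and> (\<forall>t\<in>{0..2 * n}. 0 \<le> h t) \<and>
     (\<forall>t\<in>{0..<2 * n}. \<bar>h (t + 1) - h t\<bar> = 1)"

text \<open>The interval \<open>[i, j]\<close> sits at position \<open>i + j\<close> and height \<open>j - i + 2\<close>; the minimal elements
  \<open>[i, i]\<close> have height 2, one above the peaks of the lowest path, which corresponds to the empty
  ideal.\<close>

definition ideal_below :: "int \<Rightarrow> (int \<Rightarrow> int) \<Rightarrow> int set set" where
  "ideal_below n h = {{i..j} | i j. 1 \<le> i \<and> i \<le> j \<and> j \<le> n - 1 \<and> j - i + 2 \<le> h (i + j)}"

lemma Icc_in_ideal_below_iff:
  "{i..j} \<in> ideal_below n h \<longleftrightarrow> 1 \<le> i \<and> j \<le> n - 1 \<and> j - i + 2 \<le> h (i + j)" if "i \<le> j"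
  using that by (auto simp: ideal_below_def Icc_eq_Icc)

lemma ideal_below_subset: "ideal_below n h \<subseteq> root_poset_A (n - 1)"
  by (auto simp: ideal_below_def root_poset_A_def)

lemma dyck_path_lipschitz_le:
  assumes h: "dyck_path n h" and st: "0 \<le> s" "s \<le> t" "t \<le> 2 * n"
  shows "\<bar>h t - h s\<bar> \<le> t - s \<and> even (h t - h s - (t - s))"
  using st(2,3)
proof (induction t rule: int_ge_induct)
  case base
  then show ?case by simp
next
  case (step t)
  then have "\<bar>h (t + 1) - h t\<bar> = 1"
    using h st by (auto simp: dyck_path_def)
  then have "h (t + 1) = h t + 1 \<or> h (t + 1) = h t - 1"
    by linarith
  with step show ?case
    by (elim disjE) auto
qed

lemma dyck_path_lipschitz:
  assumes "dyck_path n h" "s \<in> {0..2 * n}" "t \<in> {0..2 * n}"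
  shows "\<bar>h t - h s\<bar> \<le> \<bar>t - s\<bar>"
  using dyck_path_lipschitz_le[OF assms(1), of s t] dyck_path_lipschitz_le[OF assms(1), of t s] assms
  by (cases "s \<le> t") auto

lemma dyck_path_parity:
  assumes "dyck_path n h" "t \<in> {0..2 * n}"
  shows "even (h t - t)"
  using dyck_path_lipschitz_le[OF assms(1), of 0 t] assms by (auto simp: dyck_path_def)

lemma dyck_path_le:
  assumes "dyck_path n h" "t \<in> {0..2 * n}"
  shows "h t \<le> t" "h t \<le> 2 * n - t"
  using dyck_path_lipschitz[OF assms(1), of 0 t] dyck_path_lipschitz[OF assms(1), of "2 * n" t] assms
  by (auto simp: dyck_path_def)

text \<open>Shrinking \<open>[i, j]\<close> lowers its height by at least as much as it moves its position, and a
  path changes by at most the distance between two positions.\<close>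

lemma order_ideal_ideal_below:
  assumes h: "dyck_path n h"
  shows "order_ideal (root_poset_A (n - 1)) (ideal_below n h)"
  unfolding order_ideal_def
proof (intro conjI ballI impI ideal_below_subset)
  fix a b assume b: "b \<in> ideal_below n h" and a: "a \<in> root_poset_A (n - 1)" and ab: "a \<subseteq> b"
  from b ideal_below_subset obtain i j where ij: "b = {i..j}" "1 \<le> i" "i \<le> j" "j \<le> n - 1"
    by (blast elim: root_poset_A_cases)
  from a obtain i' j' where ij': "a = {i'..j'}" "1 \<le> i'" "i' \<le> j'" "j' \<le> n - 1"
    by (rule root_poset_A_cases)
  have "i \<le> i'" "j' \<le> j"
    using ab ij' ij by auto
  moreover have "\<bar>h (i + j) - h (i' + j')\<bar> \<le> \<bar>(i + j) - (i' + j')\<bar>"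
    using h ij ij' by (intro dyck_path_lipschitz) auto
  moreover have "j - i + 2 \<le> h (i + j)"
    using b ij by (simp add: Icc_in_ideal_below_iff)
  ultimately have "j' - i' + 2 \<le> h (i' + j')"
    by linarith
  with ij' show "a \<in> ideal_below n h"
    by (simp add: Icc_in_ideal_below_iff)
qed

text \<open>A value \<open>h t \<ge> 2\<close> is the height of an element of the poset at position \<open>t\<close>; smaller values
  are 0 or 1 and are determined by the parity of \<open>t\<close>.\<close>

lemma dyck_path_mono_ideal_below:
  assumes h: "dyck_path n h" and h': "dyck_path n h'" and sub: "ideal_below n h \<subseteq> ideal_below n h'"
    and t: "t \<in> {0..2 * n}"
  shows "h t \<le> h' t"
proof (cases "h t \<le> 1")
  case True
  have "0 \<le> h t" "0 \<le> h' t"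
    using h h' t by (auto simp: dyck_path_def)
  moreover have "even (h t - t)" "even (h' t - t)"
    using dyck_path_parity[OF h t] dyck_path_parity[OF h' t] by simp_all
  ultimately show ?thesis
    using True by presburger
next
  case False
  \<comment> \<open>The element of the poset at position \<open>t\<close> and height \<open>h t\<close>.\<close>
  define i j where "i = (t - h t + 2) div 2" and "j = (t + h t - 2) div 2"
  have "even (h t - t)"
    using h t by (rule dyck_path_parity)
  then have ij: "i + j = t" "j - i + 2 = h t"
    unfolding i_def j_def by presburger+
  moreover have "h t \<le> t" "h t \<le> 2 * n - t"
    using dyck_path_le[OF h t] by auto
  ultimately have "1 \<le> i" "i \<le> j" "j \<le> n - 1"
    using False by linarith+
  then have "{i..j} \<in> ideal_below n h"
    using ij by (simp add: Icc_in_ideal_below_iff)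
  then have "{i..j} \<in> ideal_below n h'"
    using sub by blast
  then show ?thesis
    using ij \<open>i \<le> j\<close> by (simp add: Icc_in_ideal_below_iff)
qed

text \<open>The path is the upper envelope of the tents with slopes 1 and -1 whose tops are the elements
  of \<open>J\<close> together with the peaks of the lowest path, which are written as the empty intervals \<open>[k
  + 1, k]\<close> of height 1. A maximum of tents of the same parity changes by exactly one at each step,
  and \<open>[i, j]\<close> lies below the tent of \<open>[i', j']\<close> exactly if it is contained in \<open>[i', j']\<close>.\<close>

lemma dyck_path_of_order_ideal:
  assumes n: "0 \<le> n" and J: "order_ideal (root_poset_A (n - 1)) J"
  obtains h where "dyck_path n h" "ideal_below n h = J"
proof (cases "n = 0")
  case True
  \<comment> \<open>For \<open>n = 0\<close> there are no tents, and the path is a single point.\<close>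
  then have "J = {}"
    using J by (auto simp: order_ideal_def root_poset_A_def)
  moreover have "dyck_path n (\<lambda>t. 0)" "ideal_below n (\<lambda>t. 0) = {}"
    using True by (auto simp: dyck_path_def ideal_below_def)
  ultimately show ?thesis
    using that by blast
next
  case False
  define S where
    "S = {(i, j). 1 \<le> i \<and> i \<le> j + 1 \<and> j \<le> n - 1 \<and> (i = j + 1 \<or> {i..j} \<in> J)}"
  define v where "v t s = snd s - fst s + 2 - \<bar>fst s + snd s - t\<bar>" for t and s :: "int \<times> int"
  define h where "h t = Max (v t ` S)" for t
  have "S \<subseteq> {1..n} \<times> {0..n - 1}"
    by (auto simp: S_def)
  then have fin: "finite S"
    by (rule finite_subset) simp
  have base: "(k + 1, k) \<in> S" if "0 \<le> k" "k \<le> n - 1" for k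
    using that by (simp add: S_def)
  have ne: "S \<noteq> {}"
    using base[of 0] n False by auto
  have upper: "v t s \<le> h t" if "s \<in> S" for s t
    using that fin by (simp add: h_def)
  have attained: "\<exists>s\<in>S. h t = v t s" for t
  proof -
    have "h t \<in> v t ` S"
      unfolding h_def using fin ne by (intro Max_in) auto
    then show ?thesis
      by auto
  qed
  have le: "h t \<le> c" if "\<And>s. s \<in> S \<Longrightarrow> v t s \<le> c" for t c
    using attained[of t] that by auto
  have parity: "even (h t - t)" for t
    using attained[of t] by (auto simp: v_def abs_if split: if_splits)
  have v_step: "v (t + 1) s \<le> v t s + 1" "v t s \<le> v (t + 1) s + 1" for s t
    by (simp_all add: v_def)
  have h_up: "h (t + 1) \<le> h t + 1" for t
    by (rule le, rule order_trans[OF v_step(1)]) (simp add: upper)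
  have h_down: "h t \<le> h (t + 1) + 1" for t
    by (rule le, rule order_trans[OF v_step(2)]) (simp add: upper)
  have step: "\<bar>h (t + 1) - h t\<bar> = 1" for t
  proof -
    have "h (t + 1) \<noteq> h t"
      using parity[of t] parity[of "t + 1"] by presburger
    then show ?thesis
      using h_up[of t] h_down[of t] by linarith
  qed
  have nonneg: "0 \<le> h t" if t: "t \<in> {0..2 * n}" for t
  proof (cases "t = 2 * n")
    case True
    then show ?thesis
      using upper[OF base[of "n - 1"], of t] n False by (simp add: v_def)
  next
    case False
    then have "(t div 2 + 1, t div 2) \<in> S"
      using t by (intro base) auto
    from upper[OF this, of t] show ?thesis
      unfolding v_def fst_conv snd_conv by presburger
  qed
  have "h 0 \<le> 0" "h (2 * n) \<le> 0"
    by (rule le; auto simp: v_def S_def)+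
  then have "h 0 = 0" "h (2 * n) = 0"
    using n nonneg[of 0] nonneg[of "2 * n"] by simp_all
  then have dyck: "dyck_path n h"
    using nonneg step by (simp add: dyck_path_def)
  have "{i..j} \<in> ideal_below n h \<longleftrightarrow> {i..j} \<in> J" if ij: "1 \<le> i" "i \<le> j" "j \<le> n - 1" for i j
  proof
    assume "{i..j} \<in> J"
    then have "(i, j) \<in> S"
      using ij by (simp add: S_def)
    from upper[OF this, of "i + j"] show "{i..j} \<in> ideal_below n h"
      using ij by (simp add: Icc_in_ideal_below_iff v_def)
  next
    assume "{i..j} \<in> ideal_below n h"
    then have "j - i + 2 \<le> h (i + j)"
      using ij by (simp add: Icc_in_ideal_below_iff)
    with attained obtain i' j' where s: "(i', j') \<in> S"
      and "j - i + 2 \<le> j' - i' + 2 - \<bar>i' + j' - (i + j)\<bar>"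
      unfolding v_def by (metis fst_conv snd_conv surj_pair)
    then have "i' \<le> i" "j \<le> j'" "i' \<noteq> j' + 1"
      using ij by linarith+
    then have "{i'..j'} \<in> J" "{i..j} \<subseteq> {i'..j'}"
      using s by (auto simp: S_def)
    then show "{i..j} \<in> J"
      using J ij by (auto simp: order_ideal_def Icc_in_root_poset_A_iff)
  qed
  moreover have "J \<subseteq> root_poset_A (n - 1)"
    using J by (simp add: order_ideal_def)
  ultimately have "ideal_below n h = J"
    using ideal_below_subset[of n h] by (blast elim: root_poset_A_cases)
  with dyck show ?thesis
    by (rule that)
qed

section \<open>Interval-closed sets and pairs of nested Dyck paths\<close>

definition nested_dyck_paths :: "int \<Rightarrow> (int \<Rightarrow> int) \<Rightarrow> (int \<Rightarrow> int) \<Rightarrow> bool" where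
  "nested_dyck_paths n l u \<longleftrightarrow> dyck_path n l \<and> dyck_path n u \<and> (\<forall>t\<in>{0..2 * n}. l t \<le> u t) \<and>
     (\<forall>t\<in>{0<..<2 * n}. 1 < u t \<and> u (t - 1) = u t - 1 \<and> u (t + 1) = u t - 1 \<longrightarrow> l t \<noteq> u t)"

definition region :: "int \<Rightarrow> (int \<Rightarrow> int) \<Rightarrow> (int \<Rightarrow> int) \<Rightarrow> int set set" where
  "region n l u = ideal_below n u - ideal_below n l"

definition down_closure :: "'a::order set \<Rightarrow> 'a set \<Rightarrow> 'a set" where
  "down_closure P I = {a\<in>P. \<exists>b\<in>I. a \<le> b}"

lemma region_interval_closed:
  assumes "dyck_path n l" "dyck_path n u"
  shows "region n l u \<in> interval_closed_sets (root_poset_A (n - 1))"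
  using order_ideal_ideal_below[OF assms(1)] order_ideal_ideal_below[OF assms(2)]
  unfolding region_def interval_closed_sets_def order_ideal_def
  by (auto dest: less_imp_le)

text \<open>A maximal element of the upper ideal lies exactly on the upper path, and it is a peak, since
  otherwise a larger interval would fit below the path. The lower path does not share this peak,
  so the element is missing from the lower ideal. Hence every maximal element of the upper ideal
  belongs to the region.\<close>

lemma ideal_below_eq_down_closure_region:
  assumes "nested_dyck_paths n l u"
  shows "ideal_below n u = down_closure (root_poset_A (n - 1)) (region n l u)"
proof (intro equalityI subsetI)
  fix p assume "p \<in> down_closure (root_poset_A (n - 1)) (region n l u)"
  then show "p \<in> ideal_below n u"
    using order_ideal_ideal_below[of n u] assms
    by (auto simp: down_closure_def region_def order_ideal_def nested_dyck_paths_def)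
next
  fix p assume p: "p \<in> ideal_below n u"
  have l: "dyck_path n l" and u: "dyck_path n u"
    using assms by (auto simp: nested_dyck_paths_def)
  have "finite (ideal_below n u)"
    using ideal_below_subset finite_root_poset_A by (rule finite_subset)
  from finite_has_maximal2[OF this p] obtain b where b: "b \<in> ideal_below n u" "p \<subseteq> b"
    and max: "\<And>c. c \<in> ideal_below n u \<Longrightarrow> b \<subseteq> c \<Longrightarrow> b = c"
    by auto
  from b ideal_below_subset obtain i j where ij: "b = {i..j}" "1 \<le> i" "i \<le> j" "j \<le> n - 1"
    by (blast elim: root_poset_A_cases)
  define t where "t = i + j"
  have t: "t \<in> {0<..<2 * n}" "t \<in> {0..2 * n}" "t + 1 \<in> {0..2 * n}" "t - 1 \<in> {0..2 * n}"
    using ij by (auto simp: t_def)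
  have ut: "j - i + 2 \<le> u t"
    using b ij by (simp add: Icc_in_ideal_below_iff t_def)
  \<comment> \<open>By maximality of \<open>b\<close>, no strictly larger interval lies below the upper path.\<close>
  have no_larger: "\<not> j' - i' + 2 \<le> u (i' + j')"
    if "i' \<le> i" "j \<le> j'" "(i', j') \<noteq> (i, j)" "1 \<le> i'" "j' \<le> n - 1" for i' j'
  proof
    assume "j' - i' + 2 \<le> u (i' + j')"
    then have "{i'..j'} \<in> ideal_below n u"
      using that ij by (simp add: Icc_in_ideal_below_iff)
    from max[OF this] show False
      using that ij by (auto simp: Icc_eq_Icc)
  qed
  \<comment> \<open>Otherwise, by parity, \<open>[i - 1, j + 1]\<close> would lie below the path as well; the bounds \<open>u t \<le> t\<close>
      and \<open>u t \<le> 2 * n - t\<close> keep it inside the poset.\<close>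
  have eq: "u t = j - i + 2"
  proof (rule ccontr)
    assume "u t \<noteq> j - i + 2"
    moreover have "even (u t - t)"
      using u t(2) by (rule dyck_path_parity)
    then have "even (u t - (j - i + 2))"
      unfolding t_def by presburger
    ultimately have "(j + 1) - (i - 1) + 2 \<le> u t"
      using ut by presburger
    then show False
      using no_larger[of "i - 1" "j + 1"] dyck_path_le[OF u t(2)] by (auto simp: t_def)
  qed
  have "u (t + 1) = u t - 1"
  proof (rule ccontr)
    assume "u (t + 1) \<noteq> u t - 1"
    moreover have "\<bar>u (t + 1) - u t\<bar> = 1"
      using u t by (auto simp: dyck_path_def)
    ultimately have "u (t + 1) = (j + 1) - i + 2"
      using eq by linarith
    then show False
      using no_larger[of i "j + 1"] dyck_path_le[OF u t(3)] ij by (auto simp: t_def add.assoc)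
  qed
  moreover have "u (t - 1) = u t - 1"
  proof (rule ccontr)
    assume "u (t - 1) \<noteq> u t - 1"
    moreover have "\<bar>u (t - 1 + 1) - u (t - 1)\<bar> = 1"
    proof -
      have "t - 1 \<in> {0..<2 * n}"
        using t by auto
      with u show ?thesis
        unfolding dyck_path_def by blast
    qed
    ultimately have "u (t - 1) = j - (i - 1) + 2"
      using eq by simp
    then show False
      using no_larger[of "i - 1" j] dyck_path_le[OF u t(4)] ij by (auto simp: t_def algebra_simps)
  qed
  ultimately have "l t < u t"
    using assms t eq ij unfolding nested_dyck_paths_def by (smt (verit))
  then have "b \<in> region n l u"
    using b ij eq by (simp add: region_def Icc_in_ideal_below_iff t_def)
  then show "p \<in> down_closure (root_poset_A (n - 1)) (region n l u)"
    using b p ideal_below_subset by (auto simp: down_closure_def)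
qed

lemma ideal_below_mono:
  assumes "\<And>t. t \<in> {0..2 * n} \<Longrightarrow> l t \<le> u t"
  shows "ideal_below n l \<subseteq> ideal_below n u"
proof
  fix p assume "p \<in> ideal_below n l"
  then obtain i j where ij: "p = {i..j}" "1 \<le> i" "i \<le> j" "j \<le> n - 1" "j - i + 2 \<le> l (i + j)"
    by (auto simp: ideal_below_def)
  with assms[of "i + j"] show "p \<in> ideal_below n u"
    by (simp add: Icc_in_ideal_below_iff)
qed

text \<open>The region generates the upper ideal, and the lower ideal is what remains of it outside the
  region.\<close>

lemma region_determines_nested_dyck_paths:
  assumes "nested_dyck_paths n l u" "nested_dyck_paths n l' u'" "region n l u = region n l' u'"
    and t: "t \<in> {0..2 * n}"
  shows "l t = l' t \<and> u t = u' t"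
proof -
  have U: "ideal_below n u = ideal_below n u'"
    using assms by (simp add: ideal_below_eq_down_closure_region)
  have "ideal_below n l \<subseteq> ideal_below n u" "ideal_below n l' \<subseteq> ideal_below n u'"
    using assms(1,2) by (auto simp: nested_dyck_paths_def intro!: ideal_below_mono)
  then have L: "ideal_below n l = ideal_below n l'"
    using U assms(3) by (auto simp: region_def)
  have "f t = g t"
    if "dyck_path n f" "dyck_path n g" "ideal_below n f = ideal_below n g" for f g
    using that t by (intro antisym dyck_path_mono_ideal_below[of n]) simp_all
  with U L assms(1,2) show ?thesis
    unfolding nested_dyck_paths_def by blast
qed

text \<open>The paths are those of the ideal \<open>J\<close> generated by \<open>I\<close> and of \<open>J - I\<close>. That the latter is an
  ideal is where interval-closedness enters. At a shared peak the element on the peak would be in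
  \<open>J - I\<close>, hence strictly below some element of \<open>I\<close>, and so the upper path would be higher next to
  the peak.\<close>

lemma nested_dyck_paths_of_interval_closed_set:
  assumes n: "0 \<le> n" and I: "I \<in> interval_closed_sets (root_poset_A (n - 1))"
  obtains l u where "nested_dyck_paths n l u" "region n l u = I"
proof -
  let ?P = "root_poset_A (n - 1)"
  define J where "J = down_closure ?P I"
  have IP: "I \<subseteq> ?P" and closed: "\<And>a b w. a \<in> I \<Longrightarrow> b \<in> I \<Longrightarrow> w \<in> ?P \<Longrightarrow> a < w \<Longrightarrow> w < b \<Longrightarrow> w \<in> I"
    using I unfolding interval_closed_sets_def by blast+
  have "order_ideal ?P J"
    unfolding order_ideal_def J_def down_closure_def by (blast intro: order_trans)
  from n this obtain u where u: "dyck_path n u" "ideal_below n u = J"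
    by (rule dyck_path_of_order_ideal)
  have "order_ideal ?P (J - I)"
    unfolding order_ideal_def
  proof (intro conjI ballI impI)
    fix a b assume b: "b \<in> J - I" and a: "a \<in> ?P" and ab: "a \<subseteq> b"
    from b obtain c where c: "c \<in> I" "b \<subseteq> c" "b \<in> ?P"
      by (auto simp: J_def down_closure_def)
    have "a \<notin> I"
    proof
      assume "a \<in> I"
      moreover from this have "a < b" "b < c"
        using b ab c by auto
      ultimately show False
        using closed[of a c b] b c by auto
    qed
    then show "a \<in> J - I"
      using a ab c by (auto simp: J_def down_closure_def)
  qed (auto simp: J_def down_closure_def)
  from n this obtain l where l: "dyck_path n l" "ideal_below n l = J - I"
    by (rule dyck_path_of_order_ideal)
  have "I \<subseteq> J"
    using IP by (auto simp: J_def down_closure_def)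
  then have region: "region n l u = I"
    using u l by (auto simp: region_def)
  have le: "l t \<le> u t" if "t \<in> {0..2 * n}" for t
    using l u that by (intro dyck_path_mono_ideal_below[of n]) auto
  have "l t \<noteq> u t"
    if t: "t \<in> {0<..<2 * n}" and peak: "1 < u t" "u (t - 1) = u t - 1" "u (t + 1) = u t - 1" for t
  proof
    assume eq: "l t = u t"
    \<comment> \<open>The element of the poset whose position and height are those of the shared peak.\<close>
    define i j where "i = (t - u t + 2) div 2" and "j = (t + u t - 2) div 2"
    have t': "t \<in> {0..2 * n}"
      using t by auto
    have "even (u t - t)"
      using u(1) t' by (rule dyck_path_parity)
    then have ij: "i + j = t" "j - i + 2 = u t"
      unfolding i_def j_def by presburger+
    moreover note dyck_path_le[OF u(1) t']
    ultimately have ij': "1 \<le> i" "i \<le> j" "j \<le> n - 1"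
      using peak by linarith+
    then have "{i..j} \<in> J - I"
      using eq ij by (simp flip: l(2) add: Icc_in_ideal_below_iff)
    then obtain c where c: "c \<in> I" "{i..j} \<subseteq> c" "{i..j} \<noteq> c"
      by (auto simp: J_def down_closure_def)
    then have cJ: "c \<in> ideal_below n u"
      using IP \<open>I \<subseteq> J\<close> u by auto
    then obtain i' j' where c': "c = {i'..j'}" "1 \<le> i'" "i' \<le> j'" "j' \<le> n - 1"
      using ideal_below_subset by (blast elim: root_poset_A_cases)
    have sub: "i' \<le> i" "j \<le> j'" "i' \<noteq> i \<or> j' \<noteq> j"
      using c ij' c' by auto
    have uc: "j' - i' + 2 \<le> u (i' + j')"
      using cJ c' by (simp add: Icc_in_ideal_below_iff)
    have "\<bar>u (i' + j') - u (t + 1)\<bar> \<le> \<bar>(i' + j') - (t + 1)\<bar>"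
        "\<bar>u (i' + j') - u (t - 1)\<bar> \<le> \<bar>(i' + j') - (t - 1)\<bar>"
      using t c' by (intro dyck_path_lipschitz[OF u(1)]; auto)+
    then show False
      using sub uc peak ij by linarith
  qed
  with l u le have "nested_dyck_paths n l u"
    unfolding nested_dyck_paths_def by blast
  then show ?thesis
    using region by (rule that)
qed

section \<open>Closed walks as pairs of nested Dyck paths\<close>

definition lower :: "(nat \<times> nat) list \<Rightarrow> int \<Rightarrow> int" where
  "lower w t = int (fst (w ! nat t))"

text \<open>The second coordinate is half the vertical distance of the two paths, which is even because
  both paths have the parity of the position.\<close>

definition upper :: "(nat \<times> nat) list \<Rightarrow> int \<Rightarrow> int" where
  "upper w t = int (fst (w ! nat t) + 2 * snd (w ! nat t))"

lemma nested_dyck_paths_walk: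
  assumes w: "w \<in> walks (2 * n) (0, 0)"
  shows "nested_dyck_paths (int n) (lower w) (upper w)"
proof -
  have ends: "w ! 0 = (0, 0)" "w ! (2 * n) = (0, 0)"
    and adj: "\<And>t. t < 2 * n \<Longrightarrow> adjacent (w ! t) (w ! Suc t)"
    and no_peak: "\<And>t. Suc t < 2 * n \<Longrightarrow> \<not> shared_peak (w ! t) (w ! Suc t) (w ! Suc (Suc t))"
    using w by (auto simp: walks_def)
  have step: "\<bar>lower w (t + 1) - lower w t\<bar> = 1" "\<bar>upper w (t + 1) - upper w t\<bar> = 1"
    if "t \<in> {0..<2 * int n}" for t
  proof -
    have "nat (t + 1) = Suc (nat t)" "nat t < 2 * n"
      using that by auto
    with adj[of "nat t"] show "\<bar>lower w (t + 1) - lower w t\<bar> = 1" "\<bar>upper w (t + 1) - upper w t\<bar> = 1"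
      unfolding lower_def upper_def
      by (cases "w ! nat t"; cases "w ! Suc (nat t)"; auto)+
  qed
  have nonneg: "0 \<le> lower w t" "lower w t \<le> upper w t" "0 \<le> upper w t" for t
    by (simp_all add: lower_def upper_def)
  have "nat (2 * int n) = 2 * n"
    by simp
  with ends have "lower w 0 = 0" "upper w 0 = 0" "lower w (2 * int n) = 0" "upper w (2 * int n) = 0"
    by (simp_all add: lower_def upper_def)
  with step nonneg have dyck: "dyck_path (int n) (lower w)" "dyck_path (int n) (upper w)"
    by (auto simp: dyck_path_def)
  have "lower w t \<noteq> upper w t"
    if t: "t \<in> {0<..<2 * int n}" and peak: "1 < upper w t" "upper w (t - 1) = upper w t - 1"
      "upper w (t + 1) = upper w t - 1" for t
  proof
    assume eq: "lower w t = upper w t"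
    have "lower w (t - 1) = lower w t - 1" "lower w (t + 1) = lower w t - 1"
      using step(1)[of t] step(1)[of "t - 1"] nonneg(2)[of "t - 1"] nonneg(2)[of "t + 1"] peak eq t
      by (auto simp: abs_if split: if_splits)
    moreover define s where "s = nat (t - 1)"
    then have "nat (t - 1) = s" "nat t = Suc s" "nat (t + 1) = Suc (Suc s)"
      using t by auto
    ultimately have "shared_peak (w ! s) (w ! Suc s) (w ! Suc (Suc s))"
      using eq peak unfolding lower_def upper_def
      by (cases "w ! s"; cases "w ! Suc s"; cases "w ! Suc (Suc s)") (simp add: shared_peak_def)
    moreover have "Suc s < 2 * n"
      using t s_def by auto
    ultimately show False
      using no_peak by blast
  qed
  with dyck nonneg(2) show ?thesis
    unfolding nested_dyck_paths_def by blast
qed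

lemma walk_of_nested_dyck_paths:
  assumes lu: "nested_dyck_paths (int n) l u"
  obtains w where "w \<in> walks (2 * n) (0, 0)"
    "\<And>t. t \<in> {0..2 * int n} \<Longrightarrow> lower w t = l t \<and> upper w t = u t"
proof -
  define w where "w = map (\<lambda>t. (nat (l (int t)), nat ((u (int t) - l (int t)) div 2))) [0..<Suc (2 * n)]"
  have l: "dyck_path (int n) l" and u: "dyck_path (int n) u"
    and le: "\<And>t. t \<in> {0..2 * int n} \<Longrightarrow> l t \<le> u t"
    and no_peak: "\<And>t. t \<in> {0<..<2 * int n} \<Longrightarrow> 1 < u t \<Longrightarrow> u (t - 1) = u t - 1 \<Longrightarrow>
      u (t + 1) = u t - 1 \<Longrightarrow> l t \<noteq> u t"
    using lu by (auto simp: nested_dyck_paths_def)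
  have nth: "w ! t = (nat (l (int t)), nat ((u (int t) - l (int t)) div 2))" if "t \<le> 2 * n" for t
    using that unfolding w_def by (subst nth_map) (simp_all del: upt_Suc)
  have lower_upper: "lower w t = l t \<and> upper w t = u t" if t: "t \<in> {0..2 * int n}" for t
  proof -
    have "even (l t - t)" "even (u t - t)"
      using dyck_path_parity[OF l t] dyck_path_parity[OF u t] .
    then have "even (u t - l t)"
      by presburger
    moreover have "0 \<le> l t" "l t \<le> u t"
      using l t le[OF t] by (auto simp: dyck_path_def)
    ultimately show ?thesis
      using t nth[of "nat t"] by (auto simp: lower_def upper_def)
  qed
  have at: "int (fst (w ! t)) = l (int t)" "int (fst (w ! t)) + 2 * int (snd (w ! t)) = u (int t)"
    if "t \<le> 2 * n" for t
    using lower_upper[of "int t"] that by (simp_all add: lower_def upper_def)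
  have "adjacent (w ! t) (w ! Suc t)" if "t < 2 * n" for t
  proof -
    have "\<bar>l (int t + 1) - l (int t)\<bar> = 1" "\<bar>u (int t + 1) - u (int t)\<bar> = 1"
      using l u that by (auto simp: dyck_path_def)
    then show ?thesis
      using at[of t] at[of "Suc t"] that
      by (cases "w ! t"; cases "w ! Suc t") (simp add: add.commute; linarith)
  qed
  moreover have "\<not> shared_peak (w ! t) (w ! Suc t) (w ! Suc (Suc t))" if t: "Suc t < 2 * n" for t
  proof
    assume "shared_peak (w ! t) (w ! Suc t) (w ! Suc (Suc t))"
    then have "l (int t + 1) = u (int t + 1)" "1 < u (int t + 1)"
      "u (int t) = u (int t + 1) - 1" "u (int t + 1 + 1) = u (int t + 1) - 1"
      using at[of t] at[of "Suc t"] at[of "Suc (Suc t)"] t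
      by (auto simp: shared_peak_def add_ac)
    then show False
      using no_peak[of "int t + 1"] t by auto
  qed
  moreover have "w ! 0 = (0, 0)" "w ! (2 * n) = (0, 0)"
    using l u nth[of 0] nth[of "2 * n"] by (simp_all add: dyck_path_def)
  moreover have "length w = Suc (2 * n)"
    by (simp add: w_def)
  ultimately have "w \<in> walks (2 * n) (0, 0)"
    by (simp add: walks_def)
  then show ?thesis
    using lower_upper by (rule that)
qed

lemma bij_betw_walks_interval_closed_sets:
  "bij_betw (\<lambda>w. region (int n) (lower w) (upper w)) (walks (2 * n) (0, 0))
     (interval_closed_sets (root_poset_A (int n - 1)))"
proof (rule bij_betwI')
  fix w w' assume w: "w \<in> walks (2 * n) (0, 0)" and w': "w' \<in> walks (2 * n) (0, 0)"
  show "region (int n) (lower w) (upper w) = region (int n) (lower w') (upper w') \<longleftrightarrow> w = w'"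
  proof
    assume "region (int n) (lower w) (upper w) = region (int n) (lower w') (upper w')"
    note eq = region_determines_nested_dyck_paths[OF nested_dyck_paths_walk[OF w]
        nested_dyck_paths_walk[OF w'] this]
    show "w = w'"
    proof (rule nth_equalityI)
      show "length w = length w'"
        using w w' by (simp add: walks_def)
      fix t assume "t < length w"
      then have "int t \<in> {0..2 * int n}"
        using w by (simp add: walks_def)
      from eq[OF this] show "w ! t = w' ! t"
        by (auto simp: lower_def upper_def prod_eq_iff)
    qed
  qed simp
next
  fix w assume "w \<in> walks (2 * n) (0, 0)"
  then show "region (int n) (lower w) (upper w) \<in> interval_closed_sets (root_poset_A (int n - 1))"
    using nested_dyck_paths_walk[of w n] by (simp add: nested_dyck_paths_def region_interval_closed)
next
  fix I assume "I \<in> interval_closed_sets (root_poset_A (int n - 1))"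
  then obtain l u where lu: "nested_dyck_paths (int n) l u" "region (int n) l u = I"
    using nested_dyck_paths_of_interval_closed_set[of "int n" I] by auto
  from lu(1) obtain w where w: "w \<in> walks (2 * n) (0, 0)"
    "\<And>t. t \<in> {0..2 * int n} \<Longrightarrow> lower w t = l t \<and> upper w t = u t"
    using walk_of_nested_dyck_paths by blast
  have "ideal_below (int n) (lower w) = ideal_below (int n) l"
    "ideal_below (int n) (upper w) = ideal_below (int n) u"
    using w(2) by (intro equalityI ideal_below_mono; simp)+
  with w(1) lu(2) show "\<exists>w\<in>walks (2 * n) (0, 0). I = region (int n) (lower w) (upper w)"
    by (auto simp: region_def)
qed

text \<open>Every step changes the first coordinate by one, so a closed walk has an even number of
  steps.\<close>

lemma walks_parity:
  assumes "w \<in> walks m p"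
  shows "even (fst p + m)"
proof -
  have "t \<le> m \<Longrightarrow> even (fst (w ! t) + fst p + t)" for t
  proof (induction t)
    case 0
    then show ?case
      using assms by (simp add: walks_def)
  next
    case (Suc t)
    then have "adjacent (w ! t) (w ! Suc t)"
      using assms by (simp add: walks_def)
    with Suc show ?case
      by (cases "w ! t"; cases "w ! Suc t") auto
  qed
  from this[of m] show ?thesis
    using assms by (simp add: walks_def)
qed

section \<open>The generating function\<close>

lemma fps_even_terms_sums:
  assumes "\<And>m. odd m \<Longrightarrow> fps_nth G m = 0"
  shows "(\<lambda>n. fps_const (fps_nth G (2 * n)) * fps_X ^ (2 * n)) sums (G :: 'a :: comm_ring_1 fps)"
  unfolding sums_def
proof (rule tendsto_fpsI)
  fix m
  have "fps_nth (\<Sum>n<N. fps_const (fps_nth G (2 * n)) * fps_X ^ (2 * n)) m = fps_nth G m"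
    if "m < N" for N
  proof -
    have "fps_nth (\<Sum>n<N. fps_const (fps_nth G (2 * n)) * fps_X ^ (2 * n)) m =
        (\<Sum>n<N. if m = 2 * n then fps_nth G m else 0)"
      by (auto simp: fps_sum_nth fps_X_power_nth intro!: sum.cong)
    also have "\<dots> = fps_nth G m"
    proof (cases "even m")
      case True
      then have "(\<Sum>n<N. if m = 2 * n then fps_nth G m else 0) =
          (\<Sum>n<N. if m div 2 = n then fps_nth G m else 0)"
        by (intro sum.cong) auto
      also have "\<dots> = fps_nth G m"
        using that by simp
      finally show ?thesis .
    next
      case False
      then have "m \<noteq> 2 * n" for n
        by auto
      with False assms show ?thesis
        by simp
    qed
    finally show ?thesis .
  qed
  then show "\<forall>\<^sub>F N in sequentially.
      fps_nth (\<Sum>n<N. fps_const (fps_nth G (2 * n)) * fps_X ^ (2 * n)) m = fps_nth G m"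
    unfolding eventually_sequentially by (metis Suc_le_eq)
qed

theorem theorem4p3:
  shows "(\<exists>F. functional_equation F) \<and>
    (\<forall>F. functional_equation F \<longrightarrow>
      (\<lambda>n::nat. fps_const (int (card (interval_closed_sets (root_poset_A (int n - 1)))))
                  * fps_X ^ (2 * n))
        sums (fps_at F 0 0 :: int fps))"
proof (intro conjI allI impI functional_equation_solvable)
  fix F assume F: "functional_equation F"
  have nth: "fps_nth (fps_at F 0 0 :: int fps) m = int (card (walks m (0, 0)))" for m
    by (simp add: fps_at_def bipoly_eval_0_0 coeff_functional_equation_solution[OF F])
  have "walks m (0, 0) = {}" if "odd m" for m
    using that walks_parity[of _ m "(0, 0)"] by auto
  then have odd: "fps_nth (fps_at F 0 0 :: int fps) m = 0" if "odd m" for m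
    using that by (simp add: nth)
  have "int (card (interval_closed_sets (root_poset_A (int n - 1)))) =
      fps_nth (fps_at F 0 0) (2 * n)" for n
    by (simp add: nth bij_betw_same_card[OF bij_betw_walks_interval_closed_sets])
  with fps_even_terms_sums[of "fps_at F 0 0 :: int fps", OF odd]
  show "(\<lambda>n::nat. fps_const (int (card (interval_closed_sets (root_poset_A (int n - 1)))))
      * fps_X ^ (2 * n)) sums (fps_at F 0 0 :: int fps)"
    by simp
qed

end
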